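(* Let $N$ be a 3-prime left near-ring with multiplicative center $Z$. If $N$ admits a nonzero multiplicative derivation $d : N \to N$ such that $d(N) \subseteq Z$, then $N$ is a commutative ring.
   Context: A (left) near-ring is a set $N$ with two binary operations $+$ and $\cdot$ such that $(N,+)$ is a group (not assumed abelian, written additively with identity $0$), multiplication is associative, and $x(y+z) = xy + xz$ for all $x,y,z \in N$ (right distributivity and a multiplicative identity are not assumed). $N$ is 3-prime if, for $x,y \in N$, $xNy = \{0\}$ (i.e. $xny = 0$ for all $n \in N$) implies $x = 0$ or $y = 0$. The multiplicative center is $Z = \{x \in N : yx = xy \text{ for all } y \in N\}$. A multiplicative derivation of $N$ is a map $d : N \to N$, not assumed additive, with $d(xy) = x d(y) + d(x) y$ for all $x,y \in N$; it is nonzero if it is not identically $0$. That $N$ is a commutative ring means that $(N,+)$ is abelian, multiplication is commutative, and both distributive laws hold (no identity is required). *)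

theory Defs
  imports Main
begin

class left_near_ring = group_add + semigroup_mult +
  assumes left_distrib: "x * (y + z) = x * y + x * z"

class three_prime_left_near_ring = left_near_ring +
  assumes three_prime: "range (\<lambda>n. x * n * y) = {0} \<Longrightarrow> x = 0 \<or> y = 0"

definition mult_center :: "'a::times set" where
  "mult_center = {x. \<forall>y. y * x = x * y}"

text \<open>Additivity of \<open>d\<close> is deliberately not required.\<close>

definition multiplicative_derivation :: "('a::{plus,times} \<Rightarrow> 'a) \<Rightarrow> bool" where
  "multiplicative_derivation d \<longleftrightarrow> (\<forall>x y. d (x * y) = x * d y + d x * y)"

end

theory Submission
  imports Defs
begin

text \<open>
  Since \<open>0 * d x = d x * 0 = 0\<close>, the derivation fixes every \<open>0 * x\<close>, so \<open>0 * x\<close> is central and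
  therefore \<open>0\<close>; hence nonzero central elements are cancellable. Expanding \<open>d (x * y * z)\<close> in two
  ways shows that \<open>d (x * y)\<close> distributes over multiplication by \<open>z\<close> on the right, and
  centrality of \<open>d (x * y)\<close> then reads
  \<open>d y * (x * z) + d x * (y * z) = d y * (z * x) + d x * (z * y)\<close>.
  Taking \<open>z = x\<close> gives that \<open>x\<close> is central or \<open>d x = 0\<close>; in the latter case the identity itself,
  with \<open>d y \<noteq> 0\<close>, makes \<open>x\<close> central. So multiplication is commutative, both distributive laws hold,
  and expanding \<open>(a + a) * (x + y)\<close> in two ways makes addition commutative.
\<close>

lemma mult_zero_right_near_ring: "x * 0 = (0::'a::left_near_ring)"
proof -
  have "x * 0 + x * 0 = x * 0 + 0" by (simp flip: left_distrib)
  then show ?thesis by (rule add_left_imp_eq)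
qed

lemma mult_diff_right_near_ring: "x * (y - z) = x * y - (x * z :: 'a::left_near_ring)"
  using left_distrib[of x "y - z" z] by (simp add: eq_diff_eq)

lemma mult_center_commute: "c \<in> mult_center \<Longrightarrow> y * c = c * y"
  by (simp add: mult_center_def)

lemma mult_center_zero_left:
  fixes c :: "'a::left_near_ring"
  assumes "c \<in> mult_center"
  shows "0 * c = 0"
  using mult_center_commute[OF assms, of 0] by (simp add: mult_zero_right_near_ring)

text \<open>Moving \<open>c\<close> past \<open>n\<close> turns \<open>c * n * (x - y)\<close> into
  \<open>n * (c * x - c * y) = 0\<close>, so 3-primeness applies.\<close>

lemma mult_center_cancel_left:
  fixes c x y :: "'a::three_prime_left_near_ring"
  assumes c: "c \<in> mult_center" "c \<noteq> 0" and eq: "c * x = c * y"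
  shows "x = y"
proof -
  have "c * n * (x - y) = 0" for n
  proof -
    have "c * n * (x - y) = n * (c * (x - y))"
      by (simp add: mult_center_commute[OF c(1), of n, symmetric] mult.assoc)
    also have "\<dots> = 0"
      by (simp add: mult_diff_right_near_ring eq mult_zero_right_near_ring)
    finally show ?thesis .
  qed
  then have "range (\<lambda>n. c * n * (x - y)) = {0}" by auto
  from three_prime[OF this] c(2) show ?thesis by simp
qed

lemma multiplicative_derivationD:
  "multiplicative_derivation d \<Longrightarrow> d (x * y) = x * d y + d x * y"
  by (simp add: multiplicative_derivation_def)

lemma central_derivation_zero_mult:
  fixes d :: "'a::left_near_ring \<Rightarrow> 'a"
  assumes d: "multiplicative_derivation d" and central: "\<And>x. d x \<in> mult_center"
  shows "0 * x = (0::'a)"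
proof -
  have "d 0 = 0"
    using multiplicative_derivationD[OF d, of 0 0]
    by (simp add: mult_zero_right_near_ring mult_center_zero_left[OF central])
  then have "d (0 * x) = 0 * x"
    by (simp add: multiplicative_derivationD[OF d] mult_center_zero_left[OF central])
  then have "0 * x \<in> mult_center" using central[of "0 * x"] by simp
  \<comment> \<open>Centrality gives \<open>0 * (0 * x) = 0\<close>, and the left side is
    \<open>(0 * 0) * x = 0 * x\<close>.\<close>
  from mult_center_zero_left[OF this] show ?thesis
    by (simp add: mult.assoc[symmetric] mult_zero_right_near_ring)
qed

lemma multiplicative_derivation_mult_right:
  fixes d :: "'a::left_near_ring \<Rightarrow> 'a"
  assumes "multiplicative_derivation d"
  shows "d (x * y) * z = x * d y * z + d x * y * z"
proof -
  note D = multiplicative_derivationD[OF assms]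
  have "x * y * d z + d (x * y) * z = d (x * (y * z))"
    using D[of "x * y" z] by (simp add: mult.assoc)
  also have "\<dots> = x * y * d z + (x * d y * z + d x * y * z)"
    by (simp add: D[of x "y * z"] D[of y z] left_distrib add.assoc mult.assoc)
  finally show ?thesis by simp
qed

lemma central_derivation_mult_commute:
  fixes d :: "'a::three_prime_left_near_ring \<Rightarrow> 'a"
  assumes d: "multiplicative_derivation d" and central: "\<And>x. d x \<in> mult_center"
    and nz: "d w \<noteq> 0"
  shows "x * y = y * (x::'a)"
proof -
  have key: "d y * (x * z) + d x * (y * z) = d y * (z * x) + d x * (z * y)" for x y z
  proof -
    have "d y * (x * z) + d x * (y * z) = d (x * y) * z"
      by (simp add: multiplicative_derivation_mult_right[OF d]
          mult_center_commute[OF central, of x] mult.assoc)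
    also have "\<dots> = z * d (x * y)"
      by (simp add: mult_center_commute[OF central])
    also have "\<dots> = z * x * d y + z * d x * y"
      by (simp add: multiplicative_derivationD[OF d] left_distrib mult.assoc)
    also have "\<dots> = d y * (z * x) + d x * (z * y)"
      by (simp add: mult_center_commute[OF central] mult.assoc)
    finally show ?thesis .
  qed
  show ?thesis
  proof (cases "d x = 0")
    case True
    then have "d w * (x * y) = d w * (y * x)"
      using key[of w x y] by (simp add: central_derivation_zero_mult[OF d central])
    then show ?thesis using mult_center_cancel_left[OF central nz] by blast
  next
    case False
    \<comment> \<open>Both sides of this instance end in \<open>d y * (x * x)\<close>, which
      cancels.\<close>
    have "d x * (y * x) = d x * (x * y)" using key[of y x x] by simp
    then show ?thesis using mult_center_cancel_left[OF central False] by metis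
  qed
qed

text \<open>The classical expansion of \<open>(1 + 1) * (x + y)\<close>, with a left-cancellable
  \<open>a\<close> in place of an identity.\<close>

lemma add_commute_near_ring:
  fixes a x y :: "'a::left_near_ring"
  assumes comm: "\<And>x y :: 'a. x * y = y * x"
    and cancel: "\<And>x y. a * x = a * y \<Longrightarrow> x = y"
  shows "x + y = y + x"
proof -
  have right_distrib: "(u + v) * w = u * w + v * w" for u v w :: 'a
    by (metis comm left_distrib)
  have "(a + a) * (x + y) = a * x + (a * x + (a * y + a * y))"
    by (simp add: left_distrib right_distrib add.assoc)
  moreover have "(a + a) * (x + y) = a * x + (a * y + (a * x + a * y))"
    by (subst right_distrib) (simp add: left_distrib add.assoc)
  \<comment> \<open>Both expansions start with \<open>a * x\<close> and end with
    \<open>a * y\<close>; only the middle terms differ in order.\<close>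
  ultimately have "a * x + a * y + a * y = a * y + a * x + a * y"
    by (simp add: add.assoc)
  then have "a * (x + y) = a * (y + x)"
    by (simp add: left_distrib)
  then show ?thesis by (rule cancel)
qed

theorem theorem1:
  fixes d :: "'a::three_prime_left_near_ring \<Rightarrow> 'a"
  assumes "multiplicative_derivation d"
    and "d \<noteq> (\<lambda>x. 0)"
    and "range d \<subseteq> mult_center"
  shows "class.comm_ring (+) (0::'a) (-) uminus (*)"
proof -
  have central: "d x \<in> mult_center" for x :: 'a using assms(3) by auto
  obtain w where w: "d w \<noteq> 0" using assms(2) by auto
  have comm: "x * y = y * x" for x y :: 'a
    by (rule central_derivation_mult_commute[OF assms(1) central w])
  have add_comm: "x + y = y + x" for x y :: 'a
    using comm mult_center_cancel_left[OF central w] by (rule add_commute_near_ring)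
  show ?thesis
    by unfold_locales
      (auto simp: add.assoc mult.assoc intro: comm add_comm, metis comm left_distrib)
qed

end
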